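(* There is an absolute constant $c>0$ such that the following holds. Let $G$ be a finite abelian group of order $n$. Then there exists a subset $B\subset G$ with $B=-B$ and $0\notin B$ such that the Cayley graph $G_B$ contains neither a complete subgraph nor an independent set on more than $c\left(\omega^3(n)\log\omega(n)+\log n\log\log n\right)$ vertices.
   Context: For a finite abelian group $G$ and $B\subset G$ with $B=-B$, $0\notin B$, the Cayley graph $G_B$ has vertex set $G$, and $i,j\in G$ are joined by an edge iff $i-j\in B$. An independent set is a set of vertices no two of which are joined by an edge. $\omega(n)$ denotes the number of distinct prime divisors of $n$.
   Formalization: The formal theorem assumes n ≥ 3, since for n = 1 the bound is undefined and for n = 2 it is negative while a single vertex is a clique; G ranges over finite abelian groups whose elements are natural numbers, which covers all finite abelian groups up to isomorphism. *)

theory Defs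
  imports
    Complex_Main
    "HOL-Algebra.Group"
    "HOL-Algebra.Coset"
    "HOL-Library.Ramsey"
    "HOL-Computational_Algebra.Primes"
begin

text \<open>
  Abelian groups are written multiplicatively, so \<open>i - j \<in> B\<close>, \<open>B = -B\<close> and \<open>0 \<notin> B\<close> become
  \<open>i \<otimes> inv j \<in> B\<close>, \<open>B = m_inv G ` B\<close> and \<open>\<one> \<notin> B\<close>. The vertex set of the Cayley graph is
  \<open>carrier G\<close>. Edges are two-element sets as soon as \<open>\<one> \<notin> B\<close>, and the condition on
  \<open>i, j\<close> is symmetric as soon as \<open>B = m_inv G ` B\<close>.
\<close>

definition cayley_edges :: "('a, 'b) monoid_scheme \<Rightarrow> 'a set \<Rightarrow> 'a set set" where
  "cayley_edges G B =
     {{i, j} | i j. i \<in> carrier G \<and> j \<in> carrier G \<and> i \<otimes>\<^bsub>G\<^esub> inv\<^bsub>G\<^esub> j \<in> B}"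

definition prime_omega :: "nat \<Rightarrow> nat" where
  "prime_omega n = card (prime_factors n)"

text \<open>
  A constant that is uniform over all finite abelian groups cannot be obtained by quantifying
  over groups with carrier in a polymorphic type, since it could then depend on the type. A
  statement about all finite groups with carrier in \<^typ>\<open>nat\<close> does not have this defect; the
  lemma \<open>cayley_ramsey_transfer\<close> shows that it loses no group: whatever bound holds for the
  groups of order \<open>n\<close> on \<^typ>\<open>nat\<close> holds for the groups of order \<open>n\<close> on any type.
\<close>

lemma cayley_edges_iff:
  assumes "i \<in> carrier G" and "j \<in> carrier G"
  shows "{i, j} \<in> cayley_edges G B \<longleftrightarrow>
    i \<otimes>\<^bsub>G\<^esub> inv\<^bsub>G\<^esub> j \<in> B \<or> j \<otimes>\<^bsub>G\<^esub> inv\<^bsub>G\<^esub> i \<in> B"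
  using assms unfolding cayley_edges_def mem_Collect_eq by (metis doubleton_eq_iff)

lemma cayley_edges_iso_iff:
  assumes "group H" and "group G" and g: "g \<in> iso H G"
    and B: "B \<subseteq> carrier H" and i: "i \<in> carrier H" and j: "j \<in> carrier H"
  shows "{g i, g j} \<in> cayley_edges G (g ` B) \<longleftrightarrow> {i, j} \<in> cayley_edges H B"
proof -
  interpret group_hom H G g
    using assms by (simp add: group_hom_def group_hom_axioms_def iso_def)
  have inj: "inj_on g (carrier H)" and im: "g ` carrier H = carrier G"
    using g by (auto simp: iso_def bij_betw_def)
  have *: "g a \<otimes>\<^bsub>G\<^esub> inv\<^bsub>G\<^esub> g b \<in> g ` B \<longleftrightarrow> a \<otimes>\<^bsub>H\<^esub> inv\<^bsub>H\<^esub> b \<in> B"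
    if "a \<in> carrier H" "b \<in> carrier H" for a b
  proof -
    have "g a \<otimes>\<^bsub>G\<^esub> inv\<^bsub>G\<^esub> g b = g (a \<otimes>\<^bsub>H\<^esub> inv\<^bsub>H\<^esub> b)"
      using that by simp
    then show ?thesis
      using inj_on_image_mem_iff[OF inj _ B, of "a \<otimes>\<^bsub>H\<^esub> inv\<^bsub>H\<^esub> b"] that by simp
  qed
  have "{g i, g j} \<in> cayley_edges G (g ` B) \<longleftrightarrow>
      g i \<otimes>\<^bsub>G\<^esub> inv\<^bsub>G\<^esub> g j \<in> g ` B \<or> g j \<otimes>\<^bsub>G\<^esub> inv\<^bsub>G\<^esub> g i \<in> g ` B"
    using i j by (intro cayley_edges_iff) auto
  also have "\<dots> \<longleftrightarrow> i \<otimes>\<^bsub>H\<^esub> inv\<^bsub>H\<^esub> j \<in> B \<or> j \<otimes>\<^bsub>H\<^esub> inv\<^bsub>H\<^esub> i \<in> B"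
    using * i j by simp
  also have "\<dots> \<longleftrightarrow> {i, j} \<in> cayley_edges H B"
    using cayley_edges_iff[OF i j] by blast
  finally show ?thesis .
qed

lemma finite_comm_group_iso_nat:
  fixes G :: "('a, 'b) monoid_scheme"
  assumes "comm_group G" and "finite (carrier G)"
  obtains H :: "nat monoid" and g
  where "comm_group H" and "g \<in> iso H G"
proof -
  interpret G: comm_group G by fact
  obtain g :: "nat \<Rightarrow> 'a" where g: "bij_betw g {0..<card (carrier G)} (carrier G)"
    using ex_bij_betw_nat_finite[OF assms(2)] by blast
  define S where "S = {0..<card (carrier G)}"
  define f where "f = inv_into S g"
  have gS: "bij_betw g S (carrier G)" using g by (simp add: S_def)
  have f: "bij_betw f (carrier G) S"
    using gS by (simp add: f_def bij_betw_inv_into)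
  have gf: "g (f x) = x" if "x \<in> carrier G" for x
    using gS that by (simp add: f_def bij_betw_inv_into_right)
  have fg: "f (g k) = k" if "k \<in> S" for k
    using gS that by (simp add: f_def bij_betw_inv_into_left)
  have gc: "g k \<in> carrier G" if "k \<in> S" for k
    using gS that by (auto simp: bij_betw_def)
  have fc: "f x \<in> S" if "x \<in> carrier G" for x
    using f that by (auto simp: bij_betw_def)
  define H :: "nat monoid" where
    "H = \<lparr>carrier = S, monoid.mult = (\<lambda>a b. f (g a \<otimes>\<^bsub>G\<^esub> g b)), one = f \<one>\<^bsub>G\<^esub>\<rparr>"
  have "comm_group H"
  proof (rule comm_groupI)
    fix x assume "x \<in> carrier H"
    then show "\<exists>y\<in>carrier H. y \<otimes>\<^bsub>H\<^esub> x = \<one>\<^bsub>H\<^esub>"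
      by (intro bexI[of _ "f (inv\<^bsub>G\<^esub> g x)"]) (auto simp: H_def gf gc fc)
  qed (auto simp: H_def gf gc fc fg G.m_ac)
  moreover have "g \<in> iso H G"
    using gS by (auto simp: iso_def hom_def H_def gf gc)
  ultimately show thesis by (rule that)
qed

lemma cayley_ramsey_transfer:
  fixes G :: "('a, 'b) monoid_scheme" and t :: real
  assumes nat: "\<And>H :: nat monoid. comm_group H \<Longrightarrow> finite (carrier H) \<Longrightarrow> order H = n \<Longrightarrow>
      \<exists>B \<subseteq> carrier H. m_inv H ` B = B \<and> \<one>\<^bsub>H\<^esub> \<notin> B \<and>
        (\<forall>K \<subseteq> carrier H. clique K (cayley_edges H B) \<or> indep K (cayley_edges H B) \<longrightarrow>
           real (card K) \<le> t)"
    and G: "comm_group G" "finite (carrier G)" "order G = n"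
  shows "\<exists>B \<subseteq> carrier G. m_inv G ` B = B \<and> \<one>\<^bsub>G\<^esub> \<notin> B \<and>
        (\<forall>K \<subseteq> carrier G. clique K (cayley_edges G B) \<or> indep K (cayley_edges G B) \<longrightarrow>
           real (card K) \<le> t)"
proof -
  obtain H :: "nat monoid" and g where H: "comm_group H" and g: "g \<in> iso H G"
    using finite_comm_group_iso_nat[OF G(1,2)] by blast
  have grp: "group H" "group G"
    using H G(1) by (auto simp: comm_group_def)
  interpret group_hom H G g
    using grp g by (simp add: group_hom_def group_hom_axioms_def iso_def)
  have inj: "inj_on g (carrier H)" and im: "g ` carrier H = carrier G"
    using g by (auto simp: iso_def bij_betw_def)
  have "finite (carrier H)"
    using inj im G(2) by (metis finite_imageD)
  moreover have "order H = n"
    using inj im G(3) by (metis card_image order_def)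
  ultimately obtain B where B: "B \<subseteq> carrier H" "m_inv H ` B = B" "\<one>\<^bsub>H\<^esub> \<notin> B"
    and K: "\<And>K. K \<subseteq> carrier H \<Longrightarrow> clique K (cayley_edges H B) \<or> indep K (cayley_edges H B) \<Longrightarrow>
      real (card K) \<le> t"
    using nat[OF H] by blast
  have "g ` B \<subseteq> carrier G"
    using B(1) im by blast
  moreover have "m_inv G ` (g ` B) = g ` B"
  proof -
    have "m_inv G ` (g ` B) = g ` (m_inv H ` B)"
      unfolding image_image using B(1) by (intro image_cong) auto
    then show ?thesis using B(2) by simp
  qed
  moreover have "\<one>\<^bsub>G\<^esub> \<notin> g ` B"
    using inj_on_image_mem_iff[OF inj _ B(1), of "\<one>\<^bsub>H\<^esub>"] B(3) by simp
  moreover have "real (card L) \<le> t"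
    if L: "L \<subseteq> carrier G" "clique L (cayley_edges G (g ` B)) \<or> indep L (cayley_edges G (g ` B))"
    for L
  proof -
    obtain K where K': "K \<subseteq> carrier H" "L = g ` K"
      using L(1) im by (metis subset_imageE)
    have injK: "inj_on g K"
      using inj K'(1) by (rule inj_on_subset)
    have "{g v, g w} \<in> cayley_edges G (g ` B) \<longleftrightarrow> {v, w} \<in> cayley_edges H B"
      if "v \<in> K" "w \<in> K" for v w
      using cayley_edges_iso_iff[OF grp g B(1)] that K'(1) by blast
    moreover have "g v \<noteq> g w \<longleftrightarrow> v \<noteq> w" if "v \<in> K" "w \<in> K" for v w
      using injK that by (auto simp: inj_on_def)
    ultimately have "clique K (cayley_edges H B) \<or> indep K (cayley_edges H B)"
      using L(2) unfolding K'(2) clique_def indep_def by auto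
    then show ?thesis
      using K[OF K'(1)] card_image[OF injK] K'(2) by simp
  qed
  ultimately show ?thesis by blast
qed

end

theory Submission
  imports Defs
begin

text \<open>
  For a group of order \<open>N\<close> the proof gives the bound \<open>O(log N log log N)\<close>, by a variant of the
  colour counting method of Conlon, Fox, Pham and Yepremyan.

  Colour the pair \<open>{x, y}\<close> by \<open>{x y\<inverse>, y x\<inverse>}\<close>; every vertex has at most two neighbours in each
  colour. A uniformly random set of colours defines \<open>B\<close>, and a set of vertices that spans \<open>q\<close> colours
  is a clique or an independent set with probability at most \<open>2 / 2\<^sup>q\<close>.
  It remains to bound the number of \<open>n\<close>-sets \<open>A\<close> that span \<open>q = K n\<close> colours, for \<open>K\<close> large:

  \<^item> A subset \<open>Y\<close> of \<open>A\<close> with at most \<open>n / 2\<close> elements has at least \<open>|Y| / (4 K)\<close> neighbours in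
    \<open>A - Y\<close> in some colour. Choosing the colour and then the neighbours, \<open>O(K log log N)\<close> such steps
    produce a subset of \<open>A\<close> of size of order \<open>log N\<close>, at a cost of \<open>N\<close> choices per step
    and \<open>O(K)\<close> choices per element.
  \<^item> Add further elements of \<open>A\<close> as long as each one brings at least \<open>L\<close> new colours, \<open>L\<close> of order
    \<open>log N\<close>. There are at most \<open>q / L\<close> of them, so they cost \<open>N\<close> to the power \<open>q / L\<close>.
  \<^item> When this stops at \<open>Y\<close>, every vertex of \<open>A\<close> sends at least half of its edges to \<open>Y\<close> in colours
    already spanned by \<open>Y\<close>. Only \<open>O(q)\<close> vertices have this property, so \<open>A\<close> is one of
    \<open>O(K)\<close> to the power \<open>n\<close> subsets.

  The condition that \<open>K\<close> is large costs a constant factor, since every set of \<open>(4 K + 1) n\<close> vertices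
  contains an \<open>n\<close>-set that spans \<open>K n\<close> colours, by adding vertices greedily.
\<close>

subsection \<open>Counting sets that span few colours\<close>

text \<open>The quotient of \<open>t ^ t\<close> by \<open>fact t\<close> is a single term of the
  exponential series at \<open>t\<close>, and e is at most 3.\<close>

lemma power_self_le_fact: "real t ^ t \<le> 3 ^ t * fact t"
proof -
  have "(\<Sum>n\<in>{t}. real t ^ n /\<^sub>R fact n) \<le> (\<Sum>n. real t ^ n /\<^sub>R fact n)"
    by (intro sum_le_suminf summable_exp_generic) auto
  then have "real t ^ t / fact t \<le> exp (real t)"
    by (simp add: exp_def divide_inverse mult.commute)
  also have "exp (real t) = exp 1 ^ t"
    by (simp flip: exp_of_nat_mult)
  also have "\<dots> \<le> 3 ^ t"
    using exp_le by (intro power_mono) auto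
  finally show ?thesis
    by (simp add: divide_le_eq)
qed

text \<open>The usual bound has base 3n/t. Allowing any larger base \<open>r\<close> lets factors
  with different \<open>t\<close> be multiplied as powers of one common base.\<close>

lemma binomial_le_ratio_power:
  assumes "0 < t" and "3 * real n \<le> r * real t"
  shows "real (n choose t) \<le> r ^ t"
proof -
  have "real (n choose t) * real t ^ t \<le> real (n choose t) * (3 ^ t * fact t)"
    by (intro mult_left_mono power_self_le_fact) auto
  also have "\<dots> = 3 ^ t * real ((n choose t) * fact t)"
    by simp
  also have "\<dots> \<le> 3 ^ t * real (n ^ t)"
    using binomial_fact_pow[of n t] by (intro mult_left_mono) (simp_all only: of_nat_le_iff zero_le_power zero_le_numeral)
  also have "\<dots> = (3 * real n) ^ t"
    by (simp add: power_mult_distrib)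
  also have "\<dots> \<le> (r * real t) ^ t"
    using assms by (intro power_mono) auto
  also have "\<dots> = r ^ t * real t ^ t"
    by (simp add: power_mult_distrib)
  finally show ?thesis
    using assms by simp
qed

text \<open>Each such set is the set of entries of a list of length at most \<open>z\<close>. As
  \<open>card V\<close> is at least 2, the geometric sum that counts the lists stays below its next
  term.\<close>

lemma card_bounded_subsets_le:
  assumes "finite V" and "2 \<le> card V"
  shows "card {Z. Z \<subseteq> V \<and> card Z \<le> z} \<le> card V ^ (z + 1)"
proof -
  have "{Z. Z \<subseteq> V \<and> card Z \<le> z} \<subseteq> set ` {xs. set xs \<subseteq> V \<and> length xs \<le> z}"
  proof
    fix Z assume Z: "Z \<in> {Z. Z \<subseteq> V \<and> card Z \<le> z}"
    then have "finite Z"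
      using assms(1) finite_subset by auto
    then obtain xs where "set xs = Z" "distinct xs"
      using finite_distinct_list by auto
    with Z show "Z \<in> set ` {xs. set xs \<subseteq> V \<and> length xs \<le> z}"
      by (intro image_eqI[of _ _ xs]) (auto simp: distinct_card[symmetric])
  qed
  then have "card {Z. Z \<subseteq> V \<and> card Z \<le> z} \<le> card {xs. set xs \<subseteq> V \<and> length xs \<le> z}"
    using finite_lists_length_le[OF assms(1)] by (meson surj_card_le)
  also have "\<dots> = (\<Sum>i\<le>z. card V ^ i)"
    by (rule card_lists_length_le[OF assms(1)])
  also have "\<dots> \<le> card V ^ (z + 1)"
  proof (induction z)
    case (Suc z)
    have "(\<Sum>i\<le>Suc z. card V ^ i) \<le> 2 * card V ^ (z + 1)"
      using Suc by simp
    also have "\<dots> \<le> card V * card V ^ (z + 1)"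
      using assms(2) by (intro mult_right_mono) auto
    finally show ?case by simp
  qed (use assms(2) in simp)
  finally show ?thesis .
qed

section \<open>Edge colourings in which every vertex has degree at most two in each colour\<close>

locale two_bounded_colouring =
  fixes V :: "'a set" and col :: "'a \<Rightarrow> 'a \<Rightarrow> 'c" and C :: "'c set"
  assumes finite_V: "finite V"
    and finite_C: "finite C"
    and card_C: "card C \<le> card V"
    and card_V: "2 \<le> card V"
    and col_in: "x \<in> V \<Longrightarrow> y \<in> V \<Longrightarrow> x \<noteq> y \<Longrightarrow> col x y \<in> C"
    and col_sym: "x \<in> V \<Longrightarrow> y \<in> V \<Longrightarrow> col x y = col y x"
    and col_deg: "x \<in> V \<Longrightarrow> card {y \<in> V. y \<noteq> x \<and> col x y = c} \<le> 2"
begin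

definition colours :: "'a set \<Rightarrow> 'c set" where
  "colours A = {col x y | x y. x \<in> A \<and> y \<in> A \<and> x \<noteq> y}"

lemma coloursI: "x \<in> A \<Longrightarrow> y \<in> A \<Longrightarrow> x \<noteq> y \<Longrightarrow> col x y \<in> colours A"
  unfolding colours_def by blast

lemma colours_mono: "A \<subseteq> A' \<Longrightarrow> colours A \<subseteq> colours A'"
  unfolding colours_def by blast

lemma colours_subset: "A \<subseteq> V \<Longrightarrow> colours A \<subseteq> C"
  unfolding colours_def using col_in by blast

lemma finite_colours: "A \<subseteq> V \<Longrightarrow> finite (colours A)"
  using colours_subset finite_C finite_subset by blast

lemma card_colours_mono: "A \<subseteq> A' \<Longrightarrow> A' \<subseteq> V \<Longrightarrow> card (colours A) \<le> card (colours A')"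
  by (intro card_mono finite_colours colours_mono)

lemma card_colours_le: "A \<subseteq> V \<Longrightarrow> card (colours A) \<le> card A ^ 2"
proof -
  assume "A \<subseteq> V"
  then have "finite (A \<times> A)"
    using finite_V finite_subset by auto
  moreover have "colours A \<subseteq> case_prod col ` (A \<times> A)"
    unfolding colours_def by auto
  ultimately have "card (colours A) \<le> card (A \<times> A)"
    by (rule surj_card_le)
  then show ?thesis
    by (simp add: card_cartesian_product power2_eq_square)
qed

lemma colours_insert:
  assumes "insert b A \<subseteq> V"
  shows "colours (insert b A) = colours A \<union> col b ` (A - {b})"
proof
  show "colours (insert b A) \<subseteq> colours A \<union> col b ` (A - {b})"
  proof
    fix c assume "c \<in> colours (insert b A)"
    then obtain x y where c: "c = col x y" "x \<in> insert b A" "y \<in> insert b A" "x \<noteq> y"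
      unfolding colours_def by blast
    then have "col x y = col y x"
      using assms col_sym by blast
    then have "c = col y x"
      using c by simp
    with c show "c \<in> colours A \<union> col b ` (A - {b})"
      using coloursI[of x A y] by blast
  qed
  show "colours A \<union> col b ` (A - {b}) \<subseteq> colours (insert b A)"
    using colours_mono[of A "insert b A"] coloursI[of b "insert b A"] by auto
qed

lemma card_neighbours_le:
  assumes "b \<in> V" and "A \<subseteq> V" and "finite P"
  shows "card {a \<in> A. a \<noteq> b \<and> col b a \<in> P} \<le> 2 * card P"
proof -
  have fin: "finite {y \<in> V. y \<noteq> b \<and> col b y = c}" for c
    using finite_V by auto
  have "card {a \<in> A. a \<noteq> b \<and> col b a \<in> P} \<le> card (\<Union>c\<in>P. {y \<in> V. y \<noteq> b \<and> col b y = c})"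
    using assms fin by (intro card_mono) auto
  also have "\<dots> \<le> (\<Sum>c\<in>P. card {y \<in> V. y \<noteq> b \<and> col b y = c})"
    by (rule card_UN_le[OF assms(3)])
  also have "\<dots> \<le> (\<Sum>c\<in>P. 2)"
    using col_deg[OF assms(1)] by (intro sum_mono)
  finally show ?thesis by simp
qed

text \<open>Double counting: at least half of |Y| |A| pairs join Y to A - Y. A vertex of A - Y has
  at most two neighbours in Y per colour, so averaging over the colours of A gives a colour that
  reaches many vertices.\<close>

lemma popular_colour:
  assumes A: "A \<subseteq> V" and Y: "Y \<subseteq> A" "Y \<noteq> {}" and half: "2 * card Y \<le> card A"
  shows "\<exists>c\<in>C. card Y * card A \<le> 4 * card (colours A) * card {b \<in> A - Y. \<exists>a\<in>Y. col b a = c}"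
proof (rule ccontr)
  define N where "N c = {b \<in> A - Y. \<exists>a\<in>Y. col b a = c}" for c
  let ?m = "card Y" and ?n = "card A" and ?q = "card (colours A)"
  assume "\<not> ?thesis"
  then have *: "4 * ?q * card (N c) < ?m * ?n" if "c \<in> C" for c
    using that by (force simp: N_def not_le)
  have finA: "finite A" and finY: "finite Y"
    using A Y finite_subset[OF _ finite_V] by auto
  have D: "colours A \<subseteq> C" "finite (colours A)"
    using colours_subset finite_colours A by auto
  have "?m * (?n - ?m) = card ((A - Y) \<times> Y)"
    using finA finY Y by (simp add: card_cartesian_product card_Diff_subset)
  also have "\<dots> \<le> card (\<Union>c\<in>colours A. SIGMA b:N c. {a \<in> Y. a \<noteq> b \<and> col b a \<in> {c}})"
    using finA finY D Y by (intro card_mono) (auto simp: N_def intro!: coloursI)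
  also have "\<dots> \<le> (\<Sum>c\<in>colours A. card (SIGMA b:N c. {a \<in> Y. a \<noteq> b \<and> col b a \<in> {c}}))"
    by (rule card_UN_le[OF D(2)])
  also have "\<dots> \<le> (\<Sum>c\<in>colours A. 2 * card (N c))"
  proof (intro sum_mono)
    fix c
    have "card (SIGMA b:N c. {a \<in> Y. a \<noteq> b \<and> col b a \<in> {c}})
        = (\<Sum>b\<in>N c. card {a \<in> Y. a \<noteq> b \<and> col b a \<in> {c}})"
      using finA finY by (simp add: card_SigmaI N_def)
    also have "\<dots> \<le> (\<Sum>b\<in>N c. 2 * card {c})"
      using A Y by (intro sum_mono card_neighbours_le) (auto simp: N_def)
    finally show "card (SIGMA b:N c. {a \<in> Y. a \<noteq> b \<and> col b a \<in> {c}}) \<le> 2 * card (N c)"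
      by simp
  qed
  finally have le: "?m * (?n - ?m) \<le> (\<Sum>c\<in>colours A. 2 * card (N c))" .
  have m: "0 < ?m"
    using Y finY by (simp add: card_gt_0_iff)
  \<comment> \<open>The contradiction below comes from a strict inequality between sums over the
    colours, so there has to be at least one.\<close>
  have ne: "colours A \<noteq> {}"
  proof
    assume "colours A = {}"
    with le have "?m * (?n - ?m) = 0" by simp
    with m half show False by simp
  qed
  have "?q * (?m * ?n) \<le> ?q * (?m * (2 * (?n - ?m)))"
    using half by (intro mult_left_mono) auto
  also have "\<dots> = ?q * (2 * (?m * (?n - ?m)))"
    by simp
  also have "\<dots> \<le> ?q * (2 * (\<Sum>c\<in>colours A. 2 * card (N c)))"
    using le by (intro mult_left_mono) auto
  also have "\<dots> = (\<Sum>c\<in>colours A. 4 * ?q * card (N c))"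
    by (simp add: sum_distrib_left algebra_simps)
  also have "\<dots> < (\<Sum>c\<in>colours A. ?m * ?n)"
    using * D ne by (intro sum_strict_mono) auto
  finally show False by simp
qed

section \<open>Small families with a member inside every set that spans \<open>q\<close>
  colours\<close>

definition sets_with_colours :: "nat \<Rightarrow> nat \<Rightarrow> 'a set set" where
  "sets_with_colours n q = {A. A \<subseteq> V \<and> card A = n \<and> card (colours A) = q}"

definition covering :: "nat \<Rightarrow> nat \<Rightarrow> nat \<Rightarrow> 'a set set \<Rightarrow> bool" where
  "covering n q m F \<longleftrightarrow>
     (\<forall>Y\<in>F. Y \<subseteq> V \<and> card Y = m) \<and> (\<forall>A\<in>sets_with_colours n q. \<exists>Y\<in>F. Y \<subseteq> A)"

lemma covering_finite: "covering n q m F \<Longrightarrow> finite F"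
  unfolding covering_def using finite_V by (meson finite_Pow_iff finite_subset PowI subsetI)

text \<open>Each member Y is enlarged by \<open>t\<close> of its neighbours in one colour;
  \<open>popular_colour\<close> finds that many inside A. The colour costs at most
  \<open>card V\<close>. The neighbours are chosen among at most 2m, and 3 (2m) / t is at most 24 q
  / n because \<open>t\<close> is at least mn / (4q).\<close>

lemma covering_extend:
  assumes cov: "covering n q m F" and "0 < m" "2 * m \<le> n" "0 < q"
    and card_F: "real (card F) \<le> real (card V) ^ j * (24 * real q / real n) ^ m"
    and t: "t = nat \<lceil>real m * real n / (4 * real q)\<rceil>"
  shows "\<exists>F'. covering n q (m + t) F' \<and>
    real (card F') \<le> real (card V) ^ (j + 1) * (24 * real q / real n) ^ (m + t)"
proof -
  \<comment> \<open>The neighbours are taken in all of V, since the new family must not depend on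
    A.\<close>
  define nb where "nb Y c = {b \<in> V - Y. \<exists>a\<in>Y. col b a = c}" for Y c
  define ext where "ext Y c = (\<lambda>T. Y \<union> T) ` {T. T \<subseteq> nb Y c \<and> card T = t}" for Y c
  define F' where "F' = (\<Union>Y\<in>F. \<Union>c\<in>C. ext Y c)"
  define r where "r = 24 * real q / real n"
  have F: "Y \<subseteq> V" "card Y = m" "finite Y" if "Y \<in> F" for Y
    using cov that finite_subset[OF _ finite_V] by (auto simp: covering_def)
  have fin_nb: "finite (nb Y c)" for Y c
    using finite_V by (simp add: nb_def)
  have n: "0 < n"
    using assms by simp
  have t_ge: "real m * real n \<le> real t * (4 * real q)"
  proof -
    have "real m * real n / (4 * real q) \<le> real t"
      unfolding t by linarith
    then show ?thesis
      using \<open>0 < q\<close> by (simp add: divide_le_eq)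
  qed
  have "0 < t"
  proof -
    have "0 < real m * real n"
      using \<open>0 < m\<close> n by simp
    with t_ge have "0 < real t * (4 * real q)"
      by linarith
    then show ?thesis
      by (simp add: zero_less_mult_iff)
  qed
  have card_nb: "card (nb Y c) \<le> 2 * m" if "Y \<in> F" for Y c
  proof -
    have "nb Y c \<subseteq> (\<Union>a\<in>Y. {y \<in> V. y \<noteq> a \<and> col a y = c})"
    proof
      fix b assume "b \<in> nb Y c"
      then obtain a where "b \<in> V - Y" "a \<in> Y" "col b a = c"
        by (auto simp: nb_def)
      moreover from this have "col a b = c"
        using col_sym[of a b] F[OF that] by auto
      ultimately show "b \<in> (\<Union>a\<in>Y. {y \<in> V. y \<noteq> a \<and> col a y = c})"
        by blast
    qed
    then have "card (nb Y c) \<le> card (\<Union>a\<in>Y. {y \<in> V. y \<noteq> a \<and> col a y = c})"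
      using F[OF that] finite_V by (intro card_mono) auto
    also have "\<dots> \<le> (\<Sum>a\<in>Y. card {y \<in> V. y \<noteq> a \<and> col a y = c})"
      using F[OF that] by (intro card_UN_le)
    also have "\<dots> \<le> (\<Sum>a\<in>Y. 2)"
      using F[OF that] by (intro sum_mono col_deg) auto
    finally show ?thesis
      using F[OF that] by simp
  qed
  have card_ext: "card (ext Y c) \<le> (2 * m) choose t" if "Y \<in> F" for Y c
  proof -
    have "card (ext Y c) \<le> card {T. T \<subseteq> nb Y c \<and> card T = t}"
      unfolding ext_def using fin_nb by (intro card_image_le) auto
    also have "\<dots> = card (nb Y c) choose t"
      using fin_nb by (rule n_subsets)
    also have "\<dots> \<le> (2 * m) choose t"
      using card_nb[OF that] by (rule binomial_right_mono)
    finally show ?thesis .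
  qed
  have "card F' \<le> (\<Sum>Y\<in>F. card (\<Union>c\<in>C. ext Y c))"
    unfolding F'_def by (intro card_UN_le covering_finite[OF cov])
  also have "\<dots> \<le> (\<Sum>Y\<in>F. \<Sum>c\<in>C. card (ext Y c))"
    by (intro sum_mono card_UN_le finite_C)
  also have "\<dots> \<le> (\<Sum>Y\<in>F. \<Sum>c\<in>C. (2 * m) choose t)"
    by (intro sum_mono card_ext)
  also have "\<dots> = card F * card C * ((2 * m) choose t)"
    by simp
  finally have "real (card F') \<le> real (card F * card C * ((2 * m) choose t))"
    by (simp only: of_nat_le_iff)
  also have "\<dots> = real (card F) * real (card C) * real ((2 * m) choose t)"
    by simp
  also have "\<dots> \<le> (real (card V) ^ j * r ^ m) * real (card V) * r ^ t"
  proof (intro mult_mono)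
    show "real ((2 * m) choose t) \<le> r ^ t"
      using \<open>0 < t\<close> t_ge n
      by (intro binomial_le_ratio_power) (simp_all add: r_def field_simps)
  qed (use card_F card_C in \<open>auto simp: r_def\<close>)
  also have "\<dots> = real (card V) ^ (j + 1) * r ^ (m + t)"
    by (simp add: power_add)
  finally have "real (card F') \<le> real (card V) ^ (j + 1) * r ^ (m + t)" .
  moreover have "covering n q (m + t) F'"
    unfolding covering_def
  proof (intro conjI ballI)
    fix Y' assume "Y' \<in> F'"
    then obtain Y c T where Y: "Y \<in> F" and T: "T \<subseteq> nb Y c" "card T = t" and Y': "Y' = Y \<union> T"
      unfolding F'_def ext_def by blast
    have "Y \<inter> T = {}" and "T \<subseteq> V"
      using T by (auto simp: nb_def)
    moreover have "finite T"
      using T fin_nb finite_subset by blast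
    ultimately show "Y' \<subseteq> V" "card Y' = m + t"
      using F[OF Y] T Y' by (auto simp: card_Un_disjoint)
  next
    fix A assume A: "A \<in> sets_with_colours n q"
    then obtain Y where Y: "Y \<in> F" "Y \<subseteq> A"
      using cov by (auto simp: covering_def)
    have A': "A \<subseteq> V" "card A = n" "card (colours A) = q"
      using A by (auto simp: sets_with_colours_def)
    have "Y \<noteq> {}"
      using F[OF Y(1)] \<open>0 < m\<close> by auto
    then obtain c where c: "c \<in> C"
      and "card Y * card A \<le> 4 * card (colours A) * card {b \<in> A - Y. \<exists>a\<in>Y. col b a = c}"
      using popular_colour[OF A'(1) Y(2)] A' F[OF Y(1)] \<open>2 * m \<le> n\<close> by auto
    then have "m * n \<le> 4 * q * card {b \<in> A - Y. \<exists>a\<in>Y. col b a = c}"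
      using A' F[OF Y(1)] by simp
    then have "real (m * n) \<le> real (4 * q * card {b \<in> A - Y. \<exists>a\<in>Y. col b a = c})"
      by (simp only: of_nat_le_iff)
    then have "real m * real n \<le> 4 * real q * real (card {b \<in> A - Y. \<exists>a\<in>Y. col b a = c})"
      by (simp only: of_nat_mult of_nat_numeral)
    then have "real m * real n / (4 * real q) \<le> real (card {b \<in> A - Y. \<exists>a\<in>Y. col b a = c})"
      using \<open>0 < q\<close> by (simp add: divide_le_eq mult.commute)
    then have "t \<le> card {b \<in> A - Y. \<exists>a\<in>Y. col b a = c}"
      unfolding t by linarith
    then obtain T where T: "T \<subseteq> {b \<in> A - Y. \<exists>a\<in>Y. col b a = c}" "card T = t"
      by (meson obtain_subset_with_card_n)
    then have "T \<subseteq> nb Y c"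
      using A' by (auto simp: nb_def)
    then have "Y \<union> T \<in> F'"
      unfolding F'_def ext_def using Y c T by blast
    moreover have "Y \<union> T \<subseteq> A"
      using Y T by auto
    ultimately show "\<exists>Y\<in>F'. Y \<subseteq> A" by blast
  qed
  ultimately show ?thesis
    unfolding r_def by blast
qed

text \<open>Iterates \<open>covering_extend\<close>: every step multiplies the size by at least 1 +
  n / (4q) until it reaches \<open>M\<close>. The extra factor \<open>card V\<close> pays for the
  initial vertex. While m < M, the condition 2M \<le> n supplies the hypothesis 2m \<le> n of the
  extension.\<close>

lemma covering_exists:
  assumes ne: "sets_with_colours n q \<noteq> {}" and "0 < n" "n \<le> q" "2 * M \<le> n"
  shows "\<exists>m F. covering n q m F \<and> 0 < m \<and> m \<le> n \<and>
    (M \<le> m \<or> (1 + real n / (4 * real q)) ^ j \<le> real m) \<and>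
    real (card F) \<le> real (card V) ^ (j + 1) * (24 * real q / real n) ^ m"
proof (induction j)
  case 0
  let ?F = "(\<lambda>x. {x}) ` V"
  have "covering n q 1 ?F"
    unfolding covering_def
  proof (intro conjI ballI)
    fix A assume "A \<in> sets_with_colours n q"
    then have "A \<subseteq> V" "A \<noteq> {}"
      using \<open>0 < n\<close> by (auto simp: sets_with_colours_def)
    then show "\<exists>Y\<in>?F. Y \<subseteq> A" by auto
  qed auto
  moreover have "real (card ?F) \<le> real (card V) ^ (0 + 1) * (24 * real q / real n) ^ 1"
  proof -
    have "card ?F = card V"
      by (intro card_image inj_onI) auto
    moreover have "real (card V) * 1 \<le> real (card V) * (24 * real q / real n)"
      using assms by (intro mult_left_mono) (auto simp: field_simps)
    ultimately show ?thesis by simp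
  qed
  ultimately show ?case
    using \<open>0 < n\<close> by (intro exI[of _ 1] exI[of _ ?F]) auto
next
  case (Suc j)
  then obtain m F where cov: "covering n q m F" and m: "0 < m" "m \<le> n"
    and large: "M \<le> m \<or> (1 + real n / (4 * real q)) ^ j \<le> real m"
    and card_F: "real (card F) \<le> real (card V) ^ (j + 1) * (24 * real q / real n) ^ m"
    by blast
  show ?case
  proof (cases "M \<le> m")
    case True
    have "real (card V) ^ (j + 1) \<le> real (card V) ^ (Suc j + 1)"
      using card_V by (intro power_increasing) auto
    then have "real (card V) ^ (j + 1) * (24 * real q / real n) ^ m
        \<le> real (card V) ^ (Suc j + 1) * (24 * real q / real n) ^ m"
      by (intro mult_right_mono) auto
    with cov m True card_F show ?thesis
      by (meson order_trans)
  next
    case False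
    define t where "t = nat \<lceil>real m * real n / (4 * real q)\<rceil>"
    have "2 * m \<le> n" "0 < q"
      using False assms by auto
    then obtain F' where F': "covering n q (m + t) F'"
      "real (card F') \<le> real (card V) ^ (j + 1 + 1) * (24 * real q / real n) ^ (m + t)"
      using covering_extend[OF cov m(1) _ _ card_F t_def] by blast
    \<comment> \<open>The inequality m + t \<le> n holds because some \<open>n\<close>-set contains
      a member of the new family; this is where \<open>ne\<close> enters.\<close>
    obtain A Y where "A \<in> sets_with_colours n q" "Y \<in> F'" "Y \<subseteq> A"
      using ne F'(1) unfolding covering_def by blast
    then have "card Y = m + t" "card Y \<le> card A" "card A = n"
      using F'(1) card_mono[OF finite_subset[OF _ finite_V], of A Y]
      by (auto simp: covering_def sets_with_colours_def)
    then have "m + t \<le> n" by simp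
    have "real m * real n / (4 * real q) \<le> real t"
      unfolding t_def by linarith
    then have "real m * (1 + real n / (4 * real q)) \<le> real (m + t)"
      by (simp add: algebra_simps)
    moreover have "(1 + real n / (4 * real q)) ^ j * (1 + real n / (4 * real q))
        \<le> real m * (1 + real n / (4 * real q))"
      using large False by (intro mult_right_mono) auto
    ultimately have "(1 + real n / (4 * real q)) ^ Suc j \<le> real (m + t)"
      by (simp add: mult.commute)
    then show ?thesis
      using F' m \<open>m + t \<le> n\<close> by (intro exI[of _ "m + t"] exI[of _ F']) auto
  qed
qed

section \<open>Containers: the vertices that see a set mostly in its own colours\<close>

text \<open>Beware that the container of the empty set is \<open>V\<close>.\<close>

definition container :: "'a set \<Rightarrow> 'a set" where
  "container Y = Y \<union> {x \<in> V - Y. card Y \<le> 2 * card {a \<in> Y. col x a \<in> colours Y}}"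

text \<open>Count the pairs (x, a) with x outside Y, a in Y and a colour of Y between them: each x
  in the container lies in at least |Y| / 2 of them, each a in at most twice the number of colours
  of Y.\<close>

lemma card_container_le:
  assumes "Y \<subseteq> V" and "Y \<noteq> {}"
  shows "card (container Y) \<le> card Y + 4 * card (colours Y)"
proof -
  define X where "X = {x \<in> V - Y. card Y \<le> 2 * card {a \<in> Y. col x a \<in> colours Y}}"
  have fin: "finite Y" "finite X"
    using assms(1) finite_subset[OF _ finite_V] finite_V by (auto simp: X_def)
  have "card X * card Y = (\<Sum>x\<in>X. card Y)"
    by simp
  also have "\<dots> \<le> (\<Sum>x\<in>X. 2 * card {a \<in> Y. col x a \<in> colours Y})"
    by (intro sum_mono) (simp add: X_def)
  also have "\<dots> = 2 * (\<Sum>x\<in>X. card {a \<in> Y. col x a \<in> colours Y})"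
    by (simp add: sum_distrib_left)
  also have "(\<Sum>x\<in>X. card {a \<in> Y. col x a \<in> colours Y})
      = (\<Sum>a\<in>Y. card {x \<in> X. col x a \<in> colours Y})"
    by (rule sum_multicount_gen) (use fin in auto)
  also have "\<dots> \<le> (\<Sum>a\<in>Y. 2 * card (colours Y))"
  proof (intro sum_mono)
    fix a assume "a \<in> Y"
    then have "{x \<in> X. col x a \<in> colours Y} = {x \<in> X. x \<noteq> a \<and> col a x \<in> colours Y}"
      using assms(1) col_sym by (auto simp: X_def subset_iff)
    then show "card {x \<in> X. col x a \<in> colours Y} \<le> 2 * card (colours Y)"
      using card_neighbours_le[of a X "colours Y"] assms(1) \<open>a \<in> Y\<close> finite_colours
      by (auto simp: X_def)
  qed
  finally have "card X * card Y \<le> 4 * card (colours Y) * card Y"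
    by simp
  moreover have "0 < card Y"
    using assms fin by (simp add: card_gt_0_iff)
  ultimately have "card X \<le> 4 * card (colours Y)"
    by simp
  moreover have "container Y = Y \<union> X"
    by (simp add: container_def X_def)
  ultimately show ?thesis
    using card_Un_le[of Y X] by simp
qed

text \<open>More than half of the edges from \<open>b\<close> to Y have colours new to Y, and each
  new colour occurs on at most two of them. So \<open>b\<close> brings more than |Y| / 4 new
  colours.\<close>

lemma colours_insert_notin_container:
  assumes b: "b \<in> V" "b \<notin> container Y" and Y: "Y \<subseteq> V"
  shows "card Y + 4 * card (colours Y) < 4 * card (colours (insert b Y))"
proof -
  define P where "P = col b ` Y - colours Y"
  have "b \<notin> Y"
    using b by (auto simp: container_def)
  have finP: "finite P"
    using finite_subset[OF Y finite_V] by (simp add: P_def)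
  have "Y = {a \<in> Y. a \<noteq> b \<and> col b a \<in> P} \<union> {a \<in> Y. col b a \<in> colours Y}"
    using \<open>b \<notin> Y\<close> by (auto simp: P_def)
  then have "card Y \<le> card {a \<in> Y. a \<noteq> b \<and> col b a \<in> P} + card {a \<in> Y. col b a \<in> colours Y}"
    by (metis card_Un_le)
  also have "card {a \<in> Y. a \<noteq> b \<and> col b a \<in> P} \<le> 2 * card P"
    using card_neighbours_le[OF b(1) Y finP] .
  finally have "card Y < 4 * card P"
    using b \<open>b \<notin> Y\<close> by (simp add: container_def)
  moreover have "card (colours (insert b Y)) = card (colours Y) + card P"
  proof -
    have "colours (insert b Y) = colours Y \<union> P"
      using colours_insert[of b Y] b Y \<open>b \<notin> Y\<close> by (auto simp: P_def)
    moreover have "colours Y \<inter> P = {}"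
      by (auto simp: P_def)
    ultimately show ?thesis
      using finP finite_colours[OF Y] by (simp add: card_Un_disjoint)
  qed
  ultimately show ?thesis by simp
qed

text \<open>Since 4L \<le> |Y|, every element of A outside the current container brings more than
  \<open>L\<close> new colours, so adding such elements stops within |colours A| / L rounds.\<close>

lemma subset_container:
  assumes A: "A \<subseteq> V" and Y: "Y \<subseteq> A" and L: "4 * L \<le> card Y"
  shows "\<exists>Z\<subseteq>A. card Z * L \<le> card (colours A) \<and> A \<subseteq> container (Y \<union> Z)"
proof -
  have finA: "finite A"
    using A finite_subset[OF _ finite_V] by auto
  \<comment> \<open>If \<open>b\<close> lay outside the container of \<open>Y \<union> Z\<close> for a largest good \<open>Z\<close>, then \<open>insert b Z\<close> would be good.\<close>
  define good where "good Z \<longleftrightarrow> Z \<subseteq> A \<and> card Z * L \<le> card (colours (Y \<union> Z))" for Z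
  have "good {}" by (simp add: good_def)
  moreover have "\<forall>Z. good Z \<longrightarrow> card Z < card A + 1"
    using finA by (auto simp: good_def less_Suc_eq_le intro: card_mono)
  ultimately obtain Z where Z: "good Z" and max: "\<And>Z'. good Z' \<Longrightarrow> card Z' \<le> card Z"
    using ex_has_greatest_nat[of good "{}" card "card A + 1"] by blast
  define W where "W = Y \<union> Z"
  have W: "W \<subseteq> A" "W \<subseteq> V" "finite W"
    using Z Y A finA finite_subset[of W A] by (auto simp: W_def good_def)
  have "4 * L \<le> card W"
    using L card_mono[OF W(3), of Y] by (auto simp: W_def)
  have "A \<subseteq> container W"
  proof
    fix b assume b: "b \<in> A"
    show "b \<in> container W"
    proof (rule ccontr)
      assume notin: "b \<notin> container W"
      then have "b \<notin> Z" and "finite Z"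
        using W(3) by (auto simp: W_def container_def)
      moreover have "\<not> good (insert b Z)"
        using max[of "insert b Z"] \<open>b \<notin> Z\<close> \<open>finite Z\<close> by auto
      ultimately have "card (colours (insert b W)) < (card Z + 1) * L"
        using b Z by (auto simp: good_def W_def)
      moreover have "card Z * L \<le> card (colours W)"
        using Z by (simp add: good_def W_def)
      ultimately show False
        using colours_insert_notin_container[OF _ notin W(2)] b A \<open>4 * L \<le> card W\<close> by auto
    qed
  qed
  moreover have "card Z * L \<le> card (colours A)"
    using Z card_colours_mono[OF W(1) A] by (simp add: good_def W_def)
  ultimately show ?thesis
    using Z by (auto simp: W_def good_def)
qed

text \<open>A is recovered in three choices: a member Y of a covering family, a set Z of at most
  \<open>q div L\<close> vertices, and an \<open>n\<close>-subset of the container of their union,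
  which has at most n + 4q \<le> 5q elements. The hypothesis on \<open>j\<close> makes Y reach size
  4L. The constant is 360 = 24 (3) 5.\<close>

lemma card_sets_with_colours_le:
  assumes "0 < n" "n \<le> q" "0 < L" "8 * L \<le> n"
    and j: "4 * real L \<le> (1 + real n / (4 * real q)) ^ j"
  shows "real (card (sets_with_colours n q)) \<le>
    real (card V) ^ (j + 1 + (q div L + 1)) * (360 * (real q / real n)\<^sup>2) ^ n"
proof (cases "sets_with_colours n q = {}")
  case False
  obtain m F where cov: "covering n q m F" and m: "0 < m" "m \<le> n"
    and large: "4 * L \<le> m \<or> (1 + real n / (4 * real q)) ^ j \<le> real m"
    and card_F: "real (card F) \<le> real (card V) ^ (j + 1) * (24 * real q / real n) ^ m"
    using covering_exists[OF False assms(1,2), of "4 * L" j] assms(4) by auto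
  have "4 * L \<le> m"
    using large j by linarith
  define z where "z = q div L"
  define sub where "sub = {Z. Z \<subseteq> V \<and> card Z \<le> z}"
  define ext where "ext Y Z = {A. A \<subseteq> container (Y \<union> Z) \<and> card A = n}" for Y Z
  \<comment> \<open>Only those Z with a small container are kept, so that one binomial bounds every
    term. No A is lost: its own Y and Z lie in A and span at most \<open>q\<close> colours.\<close>
  define sub' where "sub' Y = {Z \<in> sub. card (container (Y \<union> Z)) \<le> 5 * q}" for Y
  have fin_sub: "finite sub"
    using finite_V by (simp add: sub_def)
  have sub'_sub: "sub' Y \<subseteq> sub" for Y
    by (auto simp: sub'_def)
  have fin_sub': "finite (sub' Y)" for Y
    using fin_sub sub'_sub finite_subset by blast
  have fin_container: "finite (container (Y \<union> Z))" if "Y \<in> F" "Z \<in> sub" for Y Z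
    using that cov finite_subset[OF _ finite_V] by (auto simp: covering_def container_def sub_def)
  have "sets_with_colours n q \<subseteq> (\<Union>Y\<in>F. \<Union>Z\<in>sub' Y. ext Y Z)"
  proof
    fix A assume A: "A \<in> sets_with_colours n q"
    then have A': "A \<subseteq> V" "card A = n" "card (colours A) = q"
      by (auto simp: sets_with_colours_def)
    have finA: "finite A"
      using A' finite_subset[OF _ finite_V] by auto
    obtain Y where Y: "Y \<in> F" "Y \<subseteq> A"
      using A cov by (auto simp: covering_def)
    have Ym: "card Y = m"
      using Y cov by (auto simp: covering_def)
    obtain Z where Z: "Z \<subseteq> A" "card Z * L \<le> q" "A \<subseteq> container (Y \<union> Z)"
      using subset_container[OF A'(1) Y(2), of L] A' Ym \<open>4 * L \<le> m\<close> by auto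
    have YZ: "Y \<union> Z \<subseteq> A" "Y \<union> Z \<subseteq> V" "Y \<union> Z \<noteq> {}"
      using Y Z A' m Ym by auto
    have "card Z \<le> z"
      using Z(2) \<open>0 < L\<close> by (simp add: z_def less_eq_div_iff_mult_less_eq)
    moreover have "card (container (Y \<union> Z)) \<le> 5 * q"
      using card_container_le[OF YZ(2,3)] card_mono[OF finA YZ(1)] card_colours_mono[OF YZ(1) A'(1)]
        A' \<open>n \<le> q\<close> by simp
    ultimately have "Z \<in> sub' Y"
      using Z A' by (auto simp: sub'_def sub_def)
    moreover have "A \<in> ext Y Z"
      using Z A' by (simp add: ext_def)
    ultimately show "A \<in> (\<Union>Y\<in>F. \<Union>Z\<in>sub' Y. ext Y Z)"
      using Y by blast
  qed
  moreover have "finite (\<Union>Y\<in>F. \<Union>Z\<in>sub' Y. ext Y Z)"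
    using covering_finite[OF cov] fin_sub' sub'_sub fin_container
    by (fastforce simp: ext_def intro!: finite_UN_I)
  ultimately have "card (sets_with_colours n q) \<le> card (\<Union>Y\<in>F. \<Union>Z\<in>sub' Y. ext Y Z)"
    by (intro card_mono)
  also have "\<dots> \<le> (\<Sum>Y\<in>F. card (\<Union>Z\<in>sub' Y. ext Y Z))"
    by (intro card_UN_le covering_finite[OF cov])
  also have "\<dots> \<le> (\<Sum>Y\<in>F. \<Sum>Z\<in>sub' Y. card (ext Y Z))"
    by (intro sum_mono card_UN_le fin_sub')
  also have "\<dots> \<le> (\<Sum>Y\<in>F. \<Sum>Z\<in>sub' Y. (5 * q) choose n)"
  proof (intro sum_mono)
    fix Y Z assume "Y \<in> F" "Z \<in> sub' Y"
    then have "card (ext Y Z) = card (container (Y \<union> Z)) choose n"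
      unfolding ext_def using fin_container sub'_sub by (intro n_subsets) auto
    then show "card (ext Y Z) \<le> (5 * q) choose n"
      using \<open>Z \<in> sub' Y\<close> by (simp add: sub'_def binomial_right_mono)
  qed
  also have "\<dots> \<le> (\<Sum>Y\<in>F. card V ^ (z + 1) * ((5 * q) choose n))"
  proof (intro sum_mono)
    fix Y
    have "card (sub' Y) \<le> card sub"
      by (intro card_mono fin_sub sub'_sub)
    also have "\<dots> \<le> card V ^ (z + 1)"
      unfolding sub_def by (rule card_bounded_subsets_le[OF finite_V card_V])
    finally show "(\<Sum>Z\<in>sub' Y. (5 * q) choose n) \<le> card V ^ (z + 1) * ((5 * q) choose n)"
      by simp
  qed
  also have "\<dots> = card F * (card V ^ (z + 1) * ((5 * q) choose n))"
    by simp
  finally have "real (card (sets_with_colours n q))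
      \<le> real (card F * (card V ^ (z + 1) * ((5 * q) choose n)))"
    by (simp only: of_nat_le_iff)
  also have "\<dots> = real (card F) * (real (card V) ^ (z + 1) * real ((5 * q) choose n))"
    by simp
  also have "\<dots> \<le> (real (card V) ^ (j + 1) * (24 * real q / real n) ^ n) *
      (real (card V) ^ (z + 1) * (15 * real q / real n) ^ n)"
  proof (intro mult_mono)
    show "real ((5 * q) choose n) \<le> (15 * real q / real n) ^ n"
      using \<open>0 < n\<close> by (intro binomial_le_ratio_power) auto
    \<comment> \<open>The base is at least 1 because n \<le> q, so the exponent may be raised from
      \<open>m\<close> to \<open>n\<close>.\<close>
    have "(24 * real q / real n) ^ m \<le> (24 * real q / real n) ^ n"
      using m assms by (intro power_increasing) (auto simp: field_simps)
    then show "real (card F) \<le> real (card V) ^ (j + 1) * (24 * real q / real n) ^ n"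
      using card_F by (meson mult_left_mono order_trans zero_le_power of_nat_0_le_iff)
  qed auto
  also have "\<dots> = real (card V) ^ (j + 1 + (z + 1)) *
      ((24 * real q / real n) ^ n * (15 * real q / real n) ^ n)"
    by (simp add: power_add)
  also have "(24 * real q / real n) ^ n * (15 * real q / real n) ^ n
      = (360 * (real q / real n)\<^sup>2) ^ n"
    by (simp add: power_mult_distrib[symmetric] power2_eq_square)
  finally show ?thesis
    unfolding z_def .
qed simp

end

subsection \<open>Random sets of colours\<close>

text \<open>Fourth power of x/20 \<le> exp (x/20); for x \<ge> 10000 the quotient of x^2 by 20^4 is
  at least 625, which exceeds 360.\<close>

lemma quadratic_le_exp:
  assumes "10000 \<le> (x::real)"
  shows "360 * x\<^sup>2 \<le> exp (x / 5)"
proof -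
  have "360 * x\<^sup>2 \<le> x\<^sup>2 * (x\<^sup>2 / 160000)"
  proof -
    have "10000\<^sup>2 \<le> x\<^sup>2"
      using assms by (intro power_mono) auto
    then have "x\<^sup>2 * 360 \<le> x\<^sup>2 * (x\<^sup>2 / 160000)"
      by (intro mult_left_mono) auto
    then show ?thesis by simp
  qed
  also have "\<dots> = (x / 20) ^ 4"
    by (simp add: power_divide power2_eq_square power4_eq_xxxx)
  also have "\<dots> \<le> exp (x / 20) ^ 4"
  proof (intro power_mono)
    show "x / 20 \<le> exp (x / 20)"
      using exp_ge_add_one_self[of "x / 20"] by linarith
  qed (use assms in simp)
  also have "\<dots> = exp (x / 5)"
    by (simp flip: exp_of_nat_mult)
  finally show ?thesis .
qed

text \<open>Turns the total estimate exp (q/2) into \<open>2 ^ q\<close>, and also gives ln 2 \<ge>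
  1/2.\<close>

lemma exp_half_le_2: "exp (1 / 2 :: real) \<le> 2"
proof -
  have "exp (1 / 2 :: real) ^ 2 = exp 1"
    by (simp flip: exp_of_nat_mult)
  also have "\<dots> \<le> 2 ^ 2"
    using exp_le by simp
  finally show ?thesis
    by (rule power2_le_imp_le) simp
qed

context two_bounded_colouring
begin

text \<open>The exponents add up to q/2: q/5 for the powers of \<open>card V\<close>, q/5 for the
  choices per element, q/10 for 4n^2. In the union bound the factor 4n^2 pays for two kinds of
  monochromatic sets, at most n^2 values of \<open>q\<close>, and a final 1/2.\<close>

lemma few_sets_with_colours:
  assumes L: "0 < L" "10 * ln (real (card V)) \<le> real L" "8 * L \<le> n"
    and l: "0 < l" "4 * L \<le> 2 ^ l" "70 * real l * ln (real (card V)) \<le> real n"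
    and q: "10000 * n \<le> q"
  shows "4 * (real n)\<^sup>2 * real (card (sets_with_colours n q)) \<le> 2 ^ q"
proof -
  define K where "K = real q / real n"
  \<comment> \<open>By Bernoulli's inequality \<open>k\<close> extension steps at least double the
    size, so \<open>k * l\<close> steps reach \<open>2 ^ l\<close>, which is at least 4L.\<close>
  define k where "k = nat \<lceil>4 * K\<rceil>"
  let ?N = "real (card V)"
  have n: "0 < n" and nq: "n \<le> q" and q0: "0 < q"
    using L q by auto
  have K: "10000 \<le> K" and q_eq: "real q = K * real n"
    using q n by (auto simp: K_def field_simps)
  have N: "1 \<le> ?N" "0 \<le> ln ?N"
    using card_V by auto
  have k: "4 * K \<le> real k" "real k \<le> 4 * K + 1"
    using K by (auto simp: k_def)
  have "2 \<le> (1 + real n / (4 * real q)) ^ k"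
  proof -
    have "1 \<le> real k * (real n / (4 * real q))"
      using k(1) n q0 by (simp add: K_def field_simps)
    moreover have "1 + real k * (real n / (4 * real q)) \<le> (1 + real n / (4 * real q)) ^ k"
    proof (rule Bernoulli_inequality)
      have "0 \<le> real n / (4 * real q)" by simp
      then show "- 1 \<le> real n / (4 * real q)" by linarith
    qed
    ultimately show ?thesis by linarith
  qed
  then have "2 ^ l \<le> ((1 + real n / (4 * real q)) ^ k) ^ l"
    by (intro power_mono) auto
  moreover have "real (4 * L) \<le> real (2 ^ l)"
    using l(2) by (simp only: of_nat_le_iff)
  ultimately have "4 * real L \<le> (1 + real n / (4 * real q)) ^ (k * l)"
    by (simp add: power_mult)
  then have bound: "real (card (sets_with_colours n q))
      \<le> ?N ^ (k * l + 1 + (q div L + 1)) * (360 * K\<^sup>2) ^ n"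
    unfolding K_def by (intro card_sets_with_colours_le n nq L)
  have "?N ^ (k * l + 1 + (q div L + 1)) = exp (real (k * l + 1 + (q div L + 1)) * ln ?N)"
    using N by (simp only: exp_of_nat_mult exp_ln)
  also have "\<dots> \<le> exp (real q / 5)"
  proof -
    have "real (q div L * L) \<le> real q"
      by (simp only: of_nat_le_iff div_times_less_eq_dividend)
    then have "real (q div L) * ln ?N \<le> real q / real L * ln ?N"
      using N L by (intro mult_right_mono) (simp_all add: field_simps)
    also have "\<dots> = real q * (ln ?N / real L)"
      by simp
    also have "\<dots> \<le> real q * (1 / 10)"
      using L by (intro mult_left_mono) (auto simp: field_simps)
    finally have 1: "real (q div L) * ln ?N \<le> real q / 10"
      by simp
    \<comment> \<open>The 2 collects the two units in the exponent of \<open>card V\<close>. With 4K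
      + 3 \<le> 7K, the constant 70 in the hypothesis on \<open>n\<close> leaves q/10.\<close>
    have "real k * real l + 2 \<le> (4 * K + 1) * real l + 2 * real l"
      using k l by (intro add_mono mult_right_mono) auto
    also have "\<dots> = (4 * K + 3) * real l"
      by (simp add: algebra_simps)
    also have "\<dots> \<le> 7 * K * real l"
      using K by (intro mult_right_mono) auto
    finally have "(real k * real l + 2) * ln ?N \<le> 7 * K * real l * ln ?N"
      using N by (intro mult_right_mono) auto
    also have "\<dots> = K * (70 * real l * ln ?N) / 10"
      by simp
    also have "\<dots> \<le> K * real n / 10"
      using l K by (intro divide_right_mono mult_left_mono) auto
    finally have 2: "(real k * real l + 2) * ln ?N \<le> real q / 10"
      by (simp add: q_eq)
    from 1 2 show ?thesis by (simp add: algebra_simps)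
  qed
  finally have p1: "?N ^ (k * l + 1 + (q div L + 1)) \<le> exp (real q / 5)" .
  have "(360 * K\<^sup>2) ^ n \<le> exp (K / 5) ^ n"
    using quadratic_le_exp[OF K] by (intro power_mono) auto
  also have "\<dots> = exp (real q / 5)"
    by (simp add: q_eq mult.commute flip: exp_of_nat_mult)
  finally have p2: "(360 * K\<^sup>2) ^ n \<le> exp (real q / 5)" .
  have "4 * (real n)\<^sup>2 = (2 * real n)\<^sup>2"
    by (simp add: power_mult_distrib)
  also have "\<dots> \<le> (exp (real q / 20))\<^sup>2"
  proof (intro power_mono)
    have "real (10000 * n) \<le> real q"
      using q by (simp only: of_nat_le_iff)
    then have "2 * real n \<le> real q / 20"
      by simp
    also have "\<dots> \<le> exp (real q / 20)"
      using exp_ge_add_one_self[of "real q / 20"] by linarith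
    finally show "2 * real n \<le> exp (real q / 20)" .
  qed simp
  also have "\<dots> = exp (real q / 10)"
    by (simp flip: exp_of_nat_mult)
  finally have p3: "4 * (real n)\<^sup>2 \<le> exp (real q / 10)" .
  have "4 * (real n)\<^sup>2 * real (card (sets_with_colours n q))
      \<le> exp (real q / 10) * (exp (real q / 5) * exp (real q / 5))"
    using bound p1 p2 p3 by (intro mult_mono order.trans[OF bound]) auto
  also have "\<dots> = exp (1 / 2) ^ q"
    by (simp flip: exp_of_nat_mult exp_add)
  also have "\<dots> \<le> 2 ^ q"
    using exp_half_le_2 by (intro power_mono) auto
  finally show ?thesis .
qed

text \<open>Greedy choice: while Y spans fewer than \<open>k * n\<close> colours its container is
  smaller than A, and a vertex of A outside it brings more than |Y| / 4 new colours. Summing gives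
  n(n - 1) / 8 colours, which is at least kn since 8k < n.\<close>

lemma subset_with_many_colours:
  assumes A: "A \<subseteq> V" "(4 * k + 1) * n \<le> card A" and "8 * k < n"
  shows "\<exists>Y\<subseteq>A. card Y = n \<and> k * n \<le> card (colours Y)"
proof -
  have finA: "finite A"
    using A finite_subset[OF _ finite_V] by auto
  have "\<exists>Y\<subseteq>A. card Y = m \<and> (k * n \<le> card (colours Y) \<or> m * (m - 1) \<le> 8 * card (colours Y))"
    if "m \<le> n" for m
    using that
  proof (induction m)
    case (Suc m)
    then obtain Y where Y: "Y \<subseteq> A" "card Y = m"
      and Yc: "k * n \<le> card (colours Y) \<or> m * (m - 1) \<le> 8 * card (colours Y)"
      by auto
    have YV: "Y \<subseteq> V" and finY: "finite Y"
      using Y A finA finite_subset by auto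
    show ?case
    \<comment> \<open>The empty set is treated apart because its container is all of V; any first
      vertex will do.\<close>
    proof (cases "k * n \<le> card (colours Y) \<or> Y = {}")
      case True
      have "card Y < card A"
        using Suc.prems Y A(2) by (simp add: algebra_simps)
      then have "\<not> A \<subseteq> Y"
        using card_mono[OF finY] by (metis leD)
      then obtain b where b: "b \<in> A - Y"
        by blast
      then have "card (colours Y) \<le> card (colours (insert b Y))"
        using A Y by (intro card_colours_mono) auto
      then show ?thesis
        using True b Y finY by (intro exI[of _ "insert b Y"]) auto
    next
      case False
      have "card (container Y) \<le> m + 4 * card (colours Y)"
        using card_container_le[OF YV] False Y by simp
      also have "\<dots> < (4 * k + 1) * n"
        using False Suc.prems by (simp add: algebra_simps)
      finally have "card (container Y) < card A"
        using A by simp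
      moreover have "finite (container Y)"
        using finY finite_V by (simp add: container_def)
      ultimately obtain b where b: "b \<in> A" "b \<notin> container Y"
        by (metis card_mono leD subsetI)
      then have "b \<notin> Y" by (simp add: container_def)
      have "m + 4 * card (colours Y) < 4 * card (colours (insert b Y))"
        using colours_insert_notin_container[OF _ b(2) YV] b A Y by auto
      moreover have "m * (m - 1) \<le> 8 * card (colours Y)"
        using Yc False by simp
      moreover have "Suc m * m = m * (m - 1) + 2 * m"
        by (cases m) auto
      ultimately have "Suc m * (Suc m - 1) \<le> 8 * card (colours (insert b Y))"
        by simp
      then show ?thesis
        using b Y finY \<open>b \<notin> Y\<close> by (intro exI[of _ "insert b Y"]) auto
    qed
  qed auto
  then obtain Y where Y: "Y \<subseteq> A" "card Y = n"
    and "k * n \<le> card (colours Y) \<or> n * (n - 1) \<le> 8 * card (colours Y)"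
    by blast
  moreover have "8 * (k * n) \<le> n * (n - 1)"
    using \<open>8 * k < n\<close> mult_le_mono[of n n "8 * k" "n - 1"] by (simp add: algebra_simps)
  ultimately have "k * n \<le> card (colours Y)" by linarith
  with Y show ?thesis by blast
qed

text \<open>Union bound over all subsets S of C. If each fails, each is bad for some
  \<open>n\<close>-set with at least 10000 n colours, as 40001 = 4 (10000) + 1; but such
  \<open>n\<close>-sets account for at most half of all S.\<close>

lemma colour_set_without_large_monochromatic:
  assumes L: "0 < L" "10 * ln (real (card V)) \<le> real L" "8 * L \<le> n"
    and l: "0 < l" "4 * L \<le> 2 ^ l" "70 * real l * ln (real (card V)) \<le> real n"
    and n: "80000 < n"
  shows "\<exists>S\<subseteq>C. \<forall>A\<subseteq>V. colours A \<subseteq> S \<or> colours A \<inter> S = {} \<longrightarrow> card A < 40001 * n"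
proof (rule ccontr)
  assume contr: "\<not> ?thesis"
  define bad where "bad A = {S. S \<subseteq> C \<and> colours A \<subseteq> S} \<union> {S. S \<subseteq> C \<and> colours A \<inter> S = {}}" for A
  let ?I = "{10000 * n..n\<^sup>2}"
  have fin: "finite (sets_with_colours n q)" for q
    using finite_V by (simp add: sets_with_colours_def)
  have fin_bad: "finite (bad A)" for A
    using finite_C by (simp add: bad_def)
  have card_bad: "card (bad A) \<le> 2 * 2 ^ (card C - q)" if "A \<in> sets_with_colours n q" for A q
  proof -
    have A: "A \<subseteq> V" "card (colours A) = q"
      using that by (auto simp: sets_with_colours_def)
    have card_Pow_diff: "card (Pow (C - colours A)) = 2 ^ (card C - q)"
      using A finite_C colours_subset finite_colours by (simp add: card_Pow card_Diff_subset)
    have "{S. S \<subseteq> C \<and> colours A \<subseteq> S} \<subseteq> (\<lambda>T. T \<union> colours A) ` Pow (C - colours A)"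
    proof
      fix S assume "S \<in> {S. S \<subseteq> C \<and> colours A \<subseteq> S}"
      then show "S \<in> (\<lambda>T. T \<union> colours A) ` Pow (C - colours A)"
        by (intro image_eqI[of _ _ "S - colours A"]) auto
    qed
    then have "card {S. S \<subseteq> C \<and> colours A \<subseteq> S} \<le> 2 ^ (card C - q)"
      using surj_card_le[of "Pow (C - colours A)"] finite_C card_Pow_diff by fastforce
    moreover have "{S. S \<subseteq> C \<and> colours A \<inter> S = {}} = Pow (C - colours A)"
      by auto
    ultimately show ?thesis
      using card_Un_le[of "{S. S \<subseteq> C \<and> colours A \<subseteq> S}" "{S. S \<subseteq> C \<and> colours A \<inter> S = {}}"]
        card_Pow_diff
      by (simp add: bad_def)
  qed
  have "Pow C \<subseteq> (\<Union>q\<in>?I. \<Union>A\<in>sets_with_colours n q. bad A)"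
  proof
    fix S assume "S \<in> Pow C"
    then obtain A where A: "A \<subseteq> V" "colours A \<subseteq> S \<or> colours A \<inter> S = {}" "40001 * n \<le> card A"
      using contr by (auto simp: not_less)
    then obtain Y where Y: "Y \<subseteq> A" "card Y = n" "10000 * n \<le> card (colours Y)"
      using subset_with_many_colours[of A 10000 n] n by auto
    have "Y \<in> sets_with_colours n (card (colours Y))"
      using Y A by (auto simp: sets_with_colours_def)
    moreover have "card (colours Y) \<in> ?I"
      using Y A card_colours_le[of Y] by auto
    moreover have "S \<in> bad Y"
      using A(2) \<open>S \<in> Pow C\<close> colours_mono[OF Y(1)] by (auto simp: bad_def)
    ultimately show "S \<in> (\<Union>q\<in>?I. \<Union>A\<in>sets_with_colours n q. bad A)"
      by blast
  qed
  then have "card (Pow C) \<le> card (\<Union>q\<in>?I. \<Union>A\<in>sets_with_colours n q. bad A)"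
    using fin fin_bad by (intro card_mono) auto
  also have "\<dots> \<le> (\<Sum>q\<in>?I. card (\<Union>A\<in>sets_with_colours n q. bad A))"
    by (intro card_UN_le) auto
  also have "\<dots> \<le> (\<Sum>q\<in>?I. \<Sum>A\<in>sets_with_colours n q. card (bad A))"
    by (intro sum_mono card_UN_le fin)
  also have "\<dots> \<le> (\<Sum>q\<in>?I. \<Sum>A\<in>sets_with_colours n q. 2 * 2 ^ (card C - q))"
    by (intro sum_mono card_bad)
  also have "\<dots> = (\<Sum>q\<in>?I. card (sets_with_colours n q) * (2 * 2 ^ (card C - q)))"
    by simp
  finally have "real (card (Pow C))
      \<le> real (\<Sum>q\<in>?I. card (sets_with_colours n q) * (2 * 2 ^ (card C - q)))"
    by (simp only: of_nat_le_iff)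
  also have "\<dots> = (\<Sum>q\<in>?I. real (card (sets_with_colours n q)) * (2 * 2 ^ (card C - q)))"
    by simp
  also have "\<dots> \<le> (\<Sum>q\<in>?I. 2 ^ card C / (2 * (real n)\<^sup>2))"
  proof (intro sum_mono)
    fix q assume q: "q \<in> ?I"
    show "real (card (sets_with_colours n q)) * (2 * 2 ^ (card C - q)) \<le> 2 ^ card C / (2 * (real n)\<^sup>2)"
    proof (cases "sets_with_colours n q = {}")
      case False
      then obtain A where "A \<subseteq> V" "card (colours A) = q"
        by (auto simp: sets_with_colours_def)
      \<comment> \<open>Ensures that the natural subtraction \<open>card C - q\<close> is not
        truncated.\<close>
      then have "q \<le> card C"
        using colours_subset finite_C card_mono by metis
      then have "2 ^ card C = (2::real) ^ q * 2 ^ (card C - q)"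
        by (simp flip: power_add)
      moreover have "4 * (real n)\<^sup>2 * real (card (sets_with_colours n q)) * 2 ^ (card C - q)
          \<le> 2 ^ q * 2 ^ (card C - q)"
        using q by (intro mult_right_mono few_sets_with_colours[OF L l]) auto
      ultimately show ?thesis
        using n by (simp add: field_simps)
    qed simp
  qed
  also have "\<dots> = real (card ?I) * (2 ^ card C / (2 * (real n)\<^sup>2))"
    by simp
  also have "\<dots> \<le> (real n)\<^sup>2 * (2 ^ card C / (2 * (real n)\<^sup>2))"
  proof (intro mult_right_mono)
    have "card ?I \<le> n\<^sup>2" using n by simp
    then have "real (card ?I) \<le> real (n\<^sup>2)"
      by (simp only: of_nat_le_iff)
    then show "real (card ?I) \<le> (real n)\<^sup>2" by simp
  qed simp
  also have "\<dots> = 2 ^ card C / 2"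
    using n by simp
  finally show False
    using finite_C by (simp add: card_Pow)
qed

end

text \<open>\<open>L\<close> is about 10 ln N, \<open>l\<close> about the binary logarithm of 4L,
  and \<open>n\<close> of order l ln N. For N \<ge> 3 the double logarithm is at least d > 0, so
  additive constants are absorbed into \<open>c\<close>.\<close>

lemma ramsey_parameters:
  "\<exists>c>0. \<forall>N\<ge>3. \<exists>n L l. 0 < L \<and> 10 * ln (real N) \<le> real L \<and> 8 * L \<le> n \<and> 0 < l \<and> 4 * L \<le> 2 ^ l \<and>
     70 * real l * ln (real N) \<le> real n \<and> 80000 < n \<and>
     40001 * real n \<le> c * (ln (real N) * ln (ln (real N)))"
proof -
  define d where "d = ln (ln (3::real))"
  \<comment> \<open>Strictness is essential for d > 0, so e \<le> 3 does not suffice. The 21/16 is 1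
    + x + x^2 at x = 1/4.\<close>
  have ln3: "1 < ln (3::real)"
  proof -
    have "exp 1 = exp (1 / 4 :: real) ^ 4"
      by (simp flip: exp_of_nat_mult)
    also have "\<dots> \<le> (21 / 16) ^ 4"
      using exp_bound[of "1 / 4"] by (intro power_mono) (auto simp: power2_eq_square)
    also have "\<dots> < 3"
      by (simp add: power4_eq_xxxx)
    finally have "exp 1 < (3::real)" .
    then have "ln (exp 1) < ln (3::real)" by (subst ln_less_cancel_iff) auto
    then show ?thesis by simp
  qed
  then have d: "0 < d"
    by (simp add: d_def)
  define c where "c = 40001 * (70 * (7 / d + 2) + 88 / d + 80002 / d)"
  have "\<exists>n L l. 0 < L \<and> 10 * ln (real N) \<le> real L \<and> 8 * L \<le> n \<and> 0 < l \<and> 4 * L \<le> 2 ^ l \<and>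
     70 * real l * ln (real N) \<le> real n \<and> 80000 < n \<and>
     40001 * real n \<le> c * (ln (real N) * ln (ln (real N)))" if "3 \<le> N" for N :: nat
  proof -
    define x where "x = ln (real N)"
    define y where "y = ln x"
    have "ln 3 \<le> x"
      unfolding x_def using that by (subst ln_le_cancel_iff) auto
    then have x: "1 < x" using ln3 by linarith
    have y: "d \<le> y"
      unfolding y_def d_def using \<open>ln 3 \<le> x\<close> ln3 by (subst ln_le_cancel_iff) auto
    have y0: "0 < y" using y d by linarith
    define L where "L = nat \<lceil>10 * x\<rceil>"
    have L: "10 * x \<le> real L" "real L \<le> 11 * x"
      unfolding L_def using x by linarith+
    define l where "l = nat \<lceil>log 2 (4 * real L)\<rceil>"
    have "log 2 (4 * real L) \<le> real l"
      unfolding l_def by linarith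
    then have "2 powr log 2 (4 * real L) \<le> 2 powr real l"
      by (intro powr_mono) auto
    then have "4 * real L \<le> 2 ^ l"
      using L x by (simp add: powr_realpow)
    then have "real (4 * L) \<le> real (2 ^ l)"
      by simp
    then have l1: "4 * L \<le> 2 ^ l"
      by (simp only: of_nat_le_iff)
    have l0: "0 < l"
      using l1 L x by (cases "l = 0") auto
    have "1 / 2 \<le> ln (2::real)"
      using exp_half_le_2 by (subst ln_ge_iff) auto
    then have "y * 1 \<le> y * (2 * ln 2)"
      using y0 by (intro mult_left_mono) auto
    then have log_x: "log 2 x \<le> 2 * y"
      by (simp add: log_def y_def field_simps)
    \<comment> \<open>4L is at most 44x, hence below 64x; rounding up then turns the 6 into
      7.\<close>
    have "log 2 (4 * real L) \<le> log 2 (2 ^ 6 * x)"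
      using L x by (subst log_le_cancel_iff) auto
    also have "\<dots> = log 2 (2 ^ 6) + log 2 x"
      using x by (subst log_mult) auto
    also have "log 2 ((2::real) ^ 6) = 6"
      by (subst log_nat_power) auto
    also have "6 + log 2 x \<le> 6 + 2 * y"
      using log_x by simp
    finally have l2: "real l \<le> 7 + 2 * y"
      unfolding l_def using l0 l_def by linarith
    have one: "1 \<le> y / d" using y d by simp
    have "7 + 2 * y \<le> 7 * (y / d) + 2 * y"
      using one by simp
    then have l3: "real l \<le> (7 / d + 2) * y"
      using l2 by (simp add: algebra_simps)
    \<comment> \<open>The term 88x pays for 8L, as L \<le> 11x; 80001 secures 80000 < n.\<close>
    define n where "n = nat \<lceil>(70 * real l + 88) * x\<rceil> + 80001"
    have "0 \<le> (70 * real l + 88) * x" using x by simp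
    then have n: "(70 * real l + 88) * x \<le> real n" "real n \<le> (70 * real l + 88) * x + 80002" "80000 < n"
      unfolding n_def by linarith+
    have "(70 * real l + 88) * x = 70 * real l * x + 88 * x" and "0 \<le> 70 * real l * x"
      using x by (simp_all add: algebra_simps)
    then have "70 * real l * x \<le> real n" and "8 * real L \<le> real n"
      using n(1) L(2) x by linarith+
    have "(70 * real l + 88) * x \<le> (70 * ((7 / d + 2) * y) + 88 * (y / d)) * x"
      using l3 one x by (intro mult_right_mono add_mono) auto
    moreover have "80002 * 1 \<le> 80002 * (y / d * x)"
      using one x mult_mono[of 1 "y / d" 1 x] by (intro mult_left_mono) auto
    ultimately have "real n \<le> (70 * ((7 / d + 2) * y) + 88 * (y / d)) * x + 80002 * (y / d * x)"
      using n(2) by linarith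
    then have "40001 * real n
        \<le> 40001 * ((70 * ((7 / d + 2) * y) + 88 * (y / d)) * x + 80002 * (y / d * x))"
      by (rule mult_left_mono) simp
    also have "\<dots> = c * (x * y)"
      by (simp add: c_def algebra_simps)
    finally have "40001 * real n \<le> c * (x * y)" .
    moreover have "8 * L \<le> n"
      using \<open>8 * real L \<le> real n\<close> by linarith
    moreover have "0 < L" using L x by (cases "L = 0") auto
    ultimately show ?thesis
      using L l0 l1 n(3) \<open>70 * real l * x \<le> real n\<close> unfolding y_def x_def by blast
  qed
  moreover have "0 < c" using d by (simp add: c_def add_pos_pos)
  ultimately show ?thesis by blast
qed

subsection \<open>Cayley graphs\<close>

text \<open>Pairing an element with its inverse makes the colour symmetric. A colour has at most two
  elements, and given x the vertex y is determined by which of them is x \<otimes> inv y.\<close>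

lemma (in comm_group) two_bounded_colouring_cayley:
  assumes "finite (carrier G)" and "2 \<le> order G"
  shows "two_bounded_colouring (carrier G) (\<lambda>x y. {x \<otimes> inv y, y \<otimes> inv x})
    ((\<lambda>g. {g, inv g}) ` (carrier G - {\<one>}))"
proof
  show "finite (carrier G)" "2 \<le> card (carrier G)"
    using assms by (auto simp: order_def)
  show "finite ((\<lambda>g. {g, inv g}) ` (carrier G - {\<one>}))"
    using assms(1) by simp
  have "card ((\<lambda>g. {g, inv g}) ` (carrier G - {\<one>})) \<le> card (carrier G - {\<one>})"
    using assms(1) by (intro card_image_le) simp
  also have "\<dots> \<le> card (carrier G)"
    using assms(1) by (intro card_mono) auto
  finally show "card ((\<lambda>g. {g, inv g}) ` (carrier G - {\<one>})) \<le> card (carrier G)" .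
next
  fix x y assume xy: "x \<in> carrier G" "y \<in> carrier G" "x \<noteq> y"
  then have "inv (x \<otimes> inv y) = y \<otimes> inv x"
    by (simp add: inv_mult_group)
  moreover have "x \<otimes> inv y \<noteq> \<one>"
    using xy by (metis inv_closed inv_equality inv_inv)
  ultimately show "{x \<otimes> inv y, y \<otimes> inv x} \<in> (\<lambda>g. {g, inv g}) ` (carrier G - {\<one>})"
    using xy by (intro image_eqI[of _ _ "x \<otimes> inv y"]) auto
next
  fix x y
  show "{x \<otimes> inv y, y \<otimes> inv x} = {y \<otimes> inv x, x \<otimes> inv y}"
    by auto
next
  fix x c assume x: "x \<in> carrier G"
  let ?A = "{y \<in> carrier G. y \<noteq> x \<and> {x \<otimes> inv y, y \<otimes> inv x} = c}"
  show "card ?A \<le> 2"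
  proof (cases "?A = {}")
    case False
    then obtain g h where c: "c = {g, h}"
      by blast
    have "inj_on (\<lambda>y. x \<otimes> inv y) ?A"
    proof (rule inj_onI)
      fix y z assume yz: "y \<in> ?A" "z \<in> ?A" "x \<otimes> inv y = x \<otimes> inv z"
      then have "inv y = inv z"
        using x by simp
      then show "y = z"
        using yz inv_inj by (auto dest: inj_onD)
    qed
    moreover have "(\<lambda>y. x \<otimes> inv y) ` ?A \<subseteq> c"
      by auto
    ultimately have "card ?A \<le> card c"
      using c by (intro card_inj_on_le) auto
    also have "\<dots> \<le> 2"
      using c card_insert_le_m1[of 2 "{h}" g] by simp
    finally show ?thesis .
  next
    case True
    then show ?thesis by (simp only: card.empty)
  qed
qed

theorem theorem1:
  shows "\<exists>c::real. c > 0 \<and>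
    (\<forall>G :: nat monoid. comm_group G \<and> finite (carrier G) \<and> order G \<ge> 3 \<longrightarrow>
      (\<exists>B \<subseteq> carrier G. m_inv G ` B = B \<and> \<one>\<^bsub>G\<^esub> \<notin> B \<and>
        (\<forall>K \<subseteq> carrier G.
          clique K (cayley_edges G B) \<or> indep K (cayley_edges G B) \<longrightarrow>
          real (card K) \<le>
            c * (real (prime_omega (order G)) ^ 3 * ln (real (prime_omega (order G)))
                 + ln (real (order G)) * ln (ln (real (order G)))))))"
proof -
  obtain c :: real where c: "0 < c"
    and params: "\<And>N. 3 \<le> N \<Longrightarrow> \<exists>n L l. 0 < L \<and> 10 * ln (real N) \<le> real L \<and> 8 * L \<le> n \<and>
      0 < l \<and> 4 * L \<le> 2 ^ l \<and> 70 * real l * ln (real N) \<le> real n \<and> 80000 < n \<and>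
      40001 * real n \<le> c * (ln (real N) * ln (ln (real N)))"
    using ramsey_parameters by blast
  have "\<exists>B \<subseteq> carrier G. m_inv G ` B = B \<and> \<one>\<^bsub>G\<^esub> \<notin> B \<and>
        (\<forall>K \<subseteq> carrier G.
          clique K (cayley_edges G B) \<or> indep K (cayley_edges G B) \<longrightarrow>
          real (card K) \<le>
            c * (real (prime_omega (order G)) ^ 3 * ln (real (prime_omega (order G)))
                 + ln (real (order G)) * ln (ln (real (order G)))))"
    if G: "comm_group G" "finite (carrier G)" "3 \<le> order G" for G :: "nat monoid"
  proof -
    interpret comm_group G by fact
    define C where "C = (\<lambda>g. {g, inv\<^bsub>G\<^esub> g}) ` (carrier G - {\<one>\<^bsub>G\<^esub>})"
    define col where "col = (\<lambda>x y. {x \<otimes>\<^bsub>G\<^esub> inv\<^bsub>G\<^esub> y, y \<otimes>\<^bsub>G\<^esub> inv\<^bsub>G\<^esub> x})"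
    interpret two_bounded_colouring "carrier G" col C
      unfolding C_def col_def using G by (intro two_bounded_colouring_cayley) auto
    obtain n L l where nLl: "0 < L" "10 * ln (real (order G)) \<le> real L" "8 * L \<le> n"
        "0 < l" "4 * L \<le> 2 ^ l" "70 * real l * ln (real (order G)) \<le> real n" "80000 < n"
      and n: "40001 * real n \<le> c * (ln (real (order G)) * ln (ln (real (order G))))"
      using params[OF G(3)] by blast
    obtain S where S: "S \<subseteq> C"
      and mono: "\<And>K. K \<subseteq> carrier G \<Longrightarrow> colours K \<subseteq> S \<or> colours K \<inter> S = {} \<Longrightarrow> card K < 40001 * n"
      using colour_set_without_large_monochromatic[OF nLl[unfolded order_def]] by blast
    \<comment> \<open>Colours are disjoint: one containing g can only be g together with its
      inverse. Hence membership of i \<otimes> inv j in the union of S reveals that the colour of i,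
      j is in S.\<close>
    have S_elem: "s = {g, inv\<^bsub>G\<^esub> g} \<and> g \<in> carrier G \<and> g \<noteq> \<one>\<^bsub>G\<^esub>" if "s \<in> S" "g \<in> s" for s g
    proof -
      have "s \<in> C"
        using that(1) S by blast
      then obtain h where "h \<in> carrier G" "h \<noteq> \<one>\<^bsub>G\<^esub>" "s = {h, inv\<^bsub>G\<^esub> h}"
        by (auto simp: C_def)
      with that(2) show ?thesis
        by (cases "g = h") auto
    qed
    have edge: "{i, j} \<in> cayley_edges G (\<Union>S) \<longleftrightarrow> col i j \<in> S"
      if ij: "i \<in> carrier G" "j \<in> carrier G" for i j
    proof -
      have inv: "inv\<^bsub>G\<^esub> (i \<otimes>\<^bsub>G\<^esub> inv\<^bsub>G\<^esub> j) = j \<otimes>\<^bsub>G\<^esub> inv\<^bsub>G\<^esub> i"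
        "inv\<^bsub>G\<^esub> (j \<otimes>\<^bsub>G\<^esub> inv\<^bsub>G\<^esub> i) = i \<otimes>\<^bsub>G\<^esub> inv\<^bsub>G\<^esub> j"
        using ij by (simp_all add: inv_mult_group)
      have "col i j \<in> S" if "s \<in> S" "i \<otimes>\<^bsub>G\<^esub> inv\<^bsub>G\<^esub> j \<in> s \<or> j \<otimes>\<^bsub>G\<^esub> inv\<^bsub>G\<^esub> i \<in> s" for s
      proof -
        have "s = col i j"
          using that(2)
        proof
          assume "i \<otimes>\<^bsub>G\<^esub> inv\<^bsub>G\<^esub> j \<in> s"
          from S_elem[OF that(1) this] show ?thesis
            by (simp add: col_def inv)
        next
          assume "j \<otimes>\<^bsub>G\<^esub> inv\<^bsub>G\<^esub> i \<in> s"
          from S_elem[OF that(1) this] show ?thesis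
            by (simp add: col_def inv insert_commute)
        qed
        then show ?thesis using that by simp
      qed
      moreover have "i \<otimes>\<^bsub>G\<^esub> inv\<^bsub>G\<^esub> j \<in> col i j"
        by (simp add: col_def)
      ultimately show ?thesis
        unfolding cayley_edges_iff[OF ij] by blast
    qed
    \<comment> \<open>The union of the selected colours serves as B: each colour is closed under
      inversion and omits the identity.\<close>
    show ?thesis
    proof (intro exI[of _ "\<Union>S"] conjI allI impI)
      show "\<Union>S \<subseteq> carrier G" "\<one>\<^bsub>G\<^esub> \<notin> \<Union>S"
        using S_elem by blast+
      have inv_in: "inv\<^bsub>G\<^esub> g \<in> \<Union>S" and inv_inv_eq: "inv\<^bsub>G\<^esub> (inv\<^bsub>G\<^esub> g) = g"
        if g: "g \<in> \<Union>S" for g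
      proof -
        obtain s where "s \<in> S" "g \<in> s"
          using g by blast
        with S_elem[OF this] show "inv\<^bsub>G\<^esub> g \<in> \<Union>S" "inv\<^bsub>G\<^esub> (inv\<^bsub>G\<^esub> g) = g"
          by auto
      qed
      show "m_inv G ` \<Union>S = \<Union>S"
      proof
        show "m_inv G ` \<Union>S \<subseteq> \<Union>S"
          using inv_in by blast
        show "\<Union>S \<subseteq> m_inv G ` \<Union>S"
          using inv_in inv_inv_eq by (metis imageI subsetI)
      qed
    next
      fix K assume K: "K \<subseteq> carrier G"
        "clique K (cayley_edges G (\<Union>S)) \<or> indep K (cayley_edges G (\<Union>S))"
      have "colours K \<subseteq> S \<or> colours K \<inter> S = {}"
        using K(2)
      proof
        assume "clique K (cayley_edges G (\<Union>S))"
        then have "colours K \<subseteq> S"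
          using edge K(1) by (auto simp: colours_def clique_def subset_iff)
        then show ?thesis ..
      next
        assume "indep K (cayley_edges G (\<Union>S))"
        then have "colours K \<inter> S = {}"
          using edge K(1) by (auto simp: colours_def indep_def subset_iff)
        then show ?thesis ..
      qed
      then have "real (card K) \<le> real (40001 * n)"
        using mono[OF K(1)] by (simp only: of_nat_le_iff less_imp_le)
      also have "\<dots> \<le> c * (ln (real (order G)) * ln (ln (real (order G))))"
        using n by simp
      also have "\<dots> \<le> c * (real (prime_omega (order G)) ^ 3 * ln (real (prime_omega (order G)))
          + ln (real (order G)) * ln (ln (real (order G))))"
      proof -
        \<comment> \<open>The logarithm is nonnegative from 1 on, and at 0 the cube
          vanishes.\<close>
        have "0 \<le> real (prime_omega (order G)) ^ 3 * ln (real (prime_omega (order G)))"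
          by (cases "prime_omega (order G) = 0") auto
        then show ?thesis
          using c by (intro mult_left_mono) auto
      qed
      finally show "real (card K) \<le>
            c * (real (prime_omega (order G)) ^ 3 * ln (real (prime_omega (order G)))
                 + ln (real (order G)) * ln (ln (real (order G))))" .
    qed
  qed
  with c show ?thesis by blast
qed

end
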